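(* Every connected graph $G$ admits a spanning tree that is end-faithful for the topological ends of $G$; that is, there is a rooted spanning tree $T$ of $G$ such that for every topological end $\varepsilon$ of $G$ there is a unique ray $R$ in $T$ starting at the root of $T$ with $R \in \varepsilon$.
   Context: Ends: a ray is a one-way infinite path; two rays in $G$ are equivalent if no finite vertex set separates them; the equivalence classes are the ends of $G$. A vertex $v$ dominates an end $\varepsilon$ if there is a subdivided infinite star with centre $v$ all of whose leaves lie on a ray of $\varepsilon$; an end is topological if no vertex dominates it. A rooted ray of a rooted tree is a ray starting at the root. *)

theory Defs
  imports Main
begin

text \<open>
  Graphs are simple and undirected, with vertex and edge sets of arbitrary cardinality; an edge is
  a two-element set of vertices. The library of digraphs in the AFP entry Graph-Theory does not
  apply: viewed as a symmetric digraph, every graph with an edge $uv$ has the directed cycle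
  $u, v, u$, so its notions of forest and spanning tree exclude all nontrivial symmetric graphs.
\<close>

record 'a sgraph =
  vertices :: "'a set"
  edges :: "'a set set"

definition simple_graph :: "'a sgraph \<Rightarrow> bool" where
  "simple_graph G \<longleftrightarrow> (\<forall>e \<in> edges G. e \<subseteq> vertices G \<and> card e = 2)"

definition adjacent :: "'a sgraph \<Rightarrow> 'a \<Rightarrow> 'a \<Rightarrow> bool" where
  "adjacent G u v \<longleftrightarrow> {u, v} \<in> edges G"

definition fin_path :: "'a sgraph \<Rightarrow> 'a list \<Rightarrow> bool" where
  "fin_path G p \<longleftrightarrow>
     p \<noteq> [] \<and> distinct p \<and> set p \<subseteq> vertices G \<and> successively (adjacent G) p"

definition connected_graph :: "'a sgraph \<Rightarrow> bool" where
  "connected_graph G \<longleftrightarrow> vertices G \<noteq> {} \<and>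
     (\<forall>u \<in> vertices G. \<forall>v \<in> vertices G. \<exists>p. fin_path G p \<and> hd p = u \<and> last p = v)"

definition cycle_in :: "'a sgraph \<Rightarrow> 'a list \<Rightarrow> bool" where
  "cycle_in G c \<longleftrightarrow> fin_path G c \<and> 3 \<le> length c \<and> adjacent G (last c) (hd c)"

definition tree_graph :: "'a sgraph \<Rightarrow> bool" where
  "tree_graph T \<longleftrightarrow> simple_graph T \<and> connected_graph T \<and> (\<nexists>c. cycle_in T c)"

definition spanning_tree_of :: "'a sgraph \<Rightarrow> 'a sgraph \<Rightarrow> bool" where
  "spanning_tree_of T G \<longleftrightarrow>
     tree_graph T \<and> vertices T = vertices G \<and> edges T \<subseteq> edges G"

text \<open>
  A ray is represented by the sequence of its vertices, listed from its first vertex. Since a ray,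
  as a graph, has exactly one vertex of degree one, this enumeration is unique.
\<close>

definition ray :: "'a sgraph \<Rightarrow> (nat \<Rightarrow> 'a) \<Rightarrow> bool" where
  "ray G R \<longleftrightarrow> inj R \<and> range R \<subseteq> vertices G \<and> (\<forall>n. adjacent G (R n) (R (Suc n)))"

definition separates :: "'a sgraph \<Rightarrow> 'a set \<Rightarrow> 'a set \<Rightarrow> 'a set \<Rightarrow> bool" where
  "separates G X A B \<longleftrightarrow>
     (\<forall>p. fin_path G p \<and> hd p \<in> A \<and> last p \<in> B \<longrightarrow> set p \<inter> X \<noteq> {})"

definition ray_equiv :: "'a sgraph \<Rightarrow> ((nat \<Rightarrow> 'a) \<times> (nat \<Rightarrow> 'a)) set" where
  "ray_equiv G = {(R, S). ray G R \<and> ray G S \<and>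
     \<not> (\<exists>X. finite X \<and> X \<subseteq> vertices G \<and> separates G X (range R) (range S))}"

definition ends :: "'a sgraph \<Rightarrow> (nat \<Rightarrow> 'a) set set" where
  "ends G = {R. ray G R} // ray_equiv G"

text \<open>
  An infinite star with centre \<open>v\<close>, subdivided: infinitely many nontrivial paths from \<open>v\<close> which
  meet pairwise only in \<open>v\<close>. Its leaves are the last vertices of these paths. Countably many paths
  suffice, since a ray has only countably many vertices that can serve as leaves.
\<close>

definition subdivided_star :: "'a sgraph \<Rightarrow> 'a \<Rightarrow> (nat \<Rightarrow> 'a list) \<Rightarrow> bool" where
  "subdivided_star G v P \<longleftrightarrow>
     (\<forall>i. fin_path G (P i) \<and> hd (P i) = v \<and> 2 \<le> length (P i)) \<and>
     (\<forall>i j. i \<noteq> j \<longrightarrow> set (P i) \<inter> set (P j) = {v})"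

definition dominates_end :: "'a sgraph \<Rightarrow> 'a \<Rightarrow> (nat \<Rightarrow> 'a) set \<Rightarrow> bool" where
  "dominates_end G v \<epsilon> \<longleftrightarrow>
     (\<exists>P. subdivided_star G v P \<and> (\<exists>R \<in> \<epsilon>. \<forall>i. last (P i) \<in> range R))"

definition topological_ends :: "'a sgraph \<Rightarrow> (nat \<Rightarrow> 'a) set set" where
  "topological_ends G = {\<epsilon> \<in> ends G. \<not> (\<exists>v \<in> vertices G. dominates_end G v \<epsilon>)}"

definition end_faithful_for :: "'a sgraph \<Rightarrow> 'a \<Rightarrow> (nat \<Rightarrow> 'a) set set \<Rightarrow> bool" where
  "end_faithful_for T r \<Psi> \<longleftrightarrow> (\<forall>\<epsilon> \<in> \<Psi>. \<exists>!R. ray T R \<and> R 0 = r \<and> R \<in> \<epsilon>)"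


text \<open>Equivalence of rays is an equivalence relation, so that ends are its classes.\<close>

lemma adjacent_commute: "adjacent G u v \<longleftrightarrow> adjacent G v u"
  by (simp add: adjacent_def insert_commute)

lemma fin_path_rev: "fin_path G p \<Longrightarrow> fin_path G (rev p)"
  unfolding fin_path_def by (auto simp: adjacent_commute[of G] cong: successively_cong)

lemma not_separates_refl:
  assumes "ray G R" "finite X"
  shows "\<not> separates G X (range R) (range R)"
proof -
  have "infinite (range R)"
    using assms(1) by (simp add: ray_def finite_image_iff)
  then obtain n where "R n \<notin> X"
    using assms(2) by (metis finite_subset image_subsetI)
  moreover have "fin_path G [R n]"
    using assms(1) by (auto simp: ray_def fin_path_def)
  ultimately show ?thesis
    unfolding separates_def by (intro notI, elim allE[of _ "[R n]"]) auto
qed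

lemma separates_commute: "separates G X A B \<Longrightarrow> separates G X B A"
  unfolding separates_def
proof (intro allI impI)
  fix p
  assume sep: "\<forall>p. fin_path G p \<and> hd p \<in> A \<and> last p \<in> B \<longrightarrow> set p \<inter> X \<noteq> {}"
    and p: "fin_path G p \<and> hd p \<in> B \<and> last p \<in> A"
  then have "fin_path G (rev p)" "hd (rev p) \<in> A" "last (rev p) \<in> B"
    by (simp_all add: fin_path_rev hd_rev last_rev)
  with sep have "set (rev p) \<inter> X \<noteq> {}"
    by blast
  then show "set p \<inter> X \<noteq> {}"
    by simp
qed

definition reach_avoiding :: "'a sgraph \<Rightarrow> 'a set \<Rightarrow> 'a \<Rightarrow> 'a \<Rightarrow> bool" where
  "reach_avoiding G X = (\<lambda>u v. adjacent G u v \<and> v \<in> vertices G - X)\<^sup>*\<^sup>*"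

lemma fin_path_imp_reach:
  assumes "fin_path G p" "set p \<inter> X = {}"
  shows "reach_avoiding G X (hd p) (last p)"
  using assms
proof (induction p rule: rev_induct)
  case (snoc x p)
  show ?case
  proof (cases "p = []")
    case False
    then have "fin_path G p" "adjacent G (last p) x" "x \<in> vertices G - X"
      using snoc.prems by (auto simp: fin_path_def successively_append_iff)
    with snoc False show ?thesis
      by (auto simp: reach_avoiding_def intro: rtranclp.rtrancl_into_rtrancl)
  qed (simp add: reach_avoiding_def)
qed (simp add: fin_path_def)

lemma reach_imp_fin_path:
  assumes "reach_avoiding G X u v" "u \<in> vertices G - X"
  shows "\<exists>p. fin_path G p \<and> hd p = u \<and> last p = v \<and> set p \<inter> X = {}"
  using assms(1) unfolding reach_avoiding_def
proof (induction rule: rtranclp_induct)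
  case base
  show ?case using assms(2) by (intro exI[of _ "[u]"]) (auto simp: fin_path_def)
next
  case (step v w)
  then obtain p where p: "fin_path G p" "hd p = u" "last p = v" "set p \<inter> X = {}"
    by blast
  show ?case
  proof (cases "w \<in> set p")
    case True
    then obtain as bs where eq: "p = as @ w # bs"
      by (meson split_list)
    have "fin_path G (as @ [w])"
      using p(1) unfolding eq fin_path_def by (auto simp: successively_append_iff)
    moreover have "hd (as @ [w]) = u"
      using p(2) unfolding eq by (cases as) auto
    ultimately show ?thesis
      using p(4) eq by (intro exI[of _ "as @ [w]"]) auto
  next
    case False
    then show ?thesis
      using p step.hyps
      by (intro exI[of _ "p @ [w]"]) (auto simp: fin_path_def successively_append_iff)
  qed
qed

lemma reach_along_ray:
  assumes S: "ray G S" and N: "\<And>n. N \<le> n \<Longrightarrow> S n \<notin> X" and ij: "N \<le> i" "N \<le> j"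
  shows "reach_avoiding G X (S i) (S j)"
proof -
  have fwd: "reach_avoiding G X (S i) (S (i + k)) \<and> reach_avoiding G X (S (i + k)) (S i)"
    if "N \<le> i" for i k
  proof (induction k)
    case 0
    show ?case by (simp add: reach_avoiding_def)
  next
    case (Suc k)
    have adj: "adjacent G (S (i + k)) (S (i + Suc k))" "adjacent G (S (i + Suc k)) (S (i + k))"
      using S adjacent_commute[of G "S (i + k)"] by (auto simp: ray_def)
    have V: "S n \<in> vertices G - X" if "N \<le> n" for n
      using S N[OF that] by (auto simp: ray_def)
    have in_V: "S (i + k) \<in> vertices G - X" "S (i + Suc k) \<in> vertices G - X"
      using V[of "i + k"] V[of "i + Suc k"] \<open>N \<le> i\<close> by simp_all
    show ?case
      using Suc.IH adj in_V unfolding reach_avoiding_def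
      by (blast intro: rtranclp.rtrancl_into_rtrancl converse_rtranclp_into_rtranclp)
  qed
  show ?thesis
    using fwd[OF ij(1), of "j - i"] fwd[OF ij(2), of "i - j"] by (cases "i \<le> j") auto
qed

lemma ray_equiv_trans:
  assumes "(R, S) \<in> ray_equiv G" "(S, T) \<in> ray_equiv G"
  shows "(R, T) \<in> ray_equiv G"
proof -
  have rays: "ray G R" "ray G S" "ray G T"
    using assms by (auto simp: ray_equiv_def)
  have "\<not> separates G X (range R) (range T)" if X: "finite X" "X \<subseteq> vertices G" for X
  proof -
    have "finite (S -` X)"
      using X rays(2) by (simp add: ray_def finite_vimageI)
    then obtain N where "\<forall>n \<in> S -` X. n < N"
      using finite_nat_set_iff_bounded by blast
    then have N: "\<And>n. S n \<in> X \<Longrightarrow> n < N"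
      by simp
    define Y where "Y = X \<union> S ` {..<N}"
    have Y: "finite Y" "Y \<subseteq> vertices G"
      using X rays(2) by (auto simp: Y_def ray_def)
    then have "\<not> separates G Y (range R) (range S)" "\<not> separates G Y (range S) (range T)"
      using assms by (auto simp: ray_equiv_def)
    then obtain p q where
      p: "fin_path G p" "hd p \<in> range R" "last p \<in> range S" "set p \<inter> Y = {}" and
      q: "fin_path G q" "hd q \<in> range S" "last q \<in> range T" "set q \<inter> Y = {}"
      unfolding separates_def by blast
    obtain i j where ij: "last p = S i" "hd q = S j"
      using p q by blast
    have ne: "p \<noteq> []" "q \<noteq> []"
      using p q by (auto simp: fin_path_def)
    have "S i \<notin> Y" "S j \<notin> Y"
      using ne p(4) q(4) ij by (metis disjoint_iff last_in_set, metis disjoint_iff hd_in_set)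
    then have "N \<le> i" "N \<le> j"
      by (auto simp: Y_def not_less[symmetric])
    then have "reach_avoiding G X (S i) (S j)"
      using N by (intro reach_along_ray[OF rays(2), of N]) (auto simp: not_less[symmetric])
    moreover have "reach_avoiding G X (hd p) (S i)" "reach_avoiding G X (S j) (last q)"
      using fin_path_imp_reach[of G p X] fin_path_imp_reach[of G q X] p q ij
      by (auto simp: Y_def)
    ultimately have "reach_avoiding G X (hd p) (last q)"
      unfolding reach_avoiding_def by (meson rtranclp_trans)
    moreover have "hd p \<in> vertices G - X"
      using p(1,4) hd_in_set[OF ne(1)] unfolding Y_def fin_path_def by blast
    ultimately obtain r where
      "fin_path G r" "hd r = hd p" "last r = last q" "set r \<inter> X = {}"
      using reach_imp_fin_path by metis
    then show ?thesis
      using p(2) q(3) unfolding separates_def by metis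
  qed
  with rays show ?thesis
    by (auto simp: ray_equiv_def)
qed

lemma equiv_ray_equiv: "equiv {R. ray G R} (ray_equiv G)"
proof (rule equivI)
  show "ray_equiv G \<subseteq> {R. ray G R} \<times> {R. ray G R}"
    by (auto simp: ray_equiv_def)
  show "refl_on {R. ray G R} (ray_equiv G)"
    by (simp add: refl_on_def ray_equiv_def not_separates_refl)
  show "sym (ray_equiv G)"
  proof (rule symI)
    fix R S
    assume "(R, S) \<in> ray_equiv G"
    then show "(S, R) \<in> ray_equiv G"
      using separates_commute[of G _ "range S" "range R"] unfolding ray_equiv_def
      by (simp only: mem_Collect_eq prod.case) meson
  qed
  show "trans (ray_equiv G)"
    by (rule transI) (rule ray_equiv_trans)
qed

end

theory Submission
  imports Defs
begin

text \<open>
  Call a vertex set \<open>U\<close> escapable if every undominated end \<open>\<epsilon>\<close> has a finite set \<open>X\<close> for which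
  $C(X, \epsilon)$ avoids \<open>U\<close>. Escapability passes from \<open>U\<close> to $U \cup N(U)$, because each of
  the finitely many vertices of \<open>X\<close> can itself be separated from \<open>\<epsilon>\<close> by a finite set; and it
  passes from \<open>U\<close> to the union of the paths from \<open>U\<close> to the root in a rooted tree, because the
  part of that union inside $C(X, \epsilon)$ lies on the paths from \<open>X\<close> to the root.

  Hence there are escapable sets $W_0 = \{r\} \subseteq W_1 \subseteq \dots$ exhausting $G$ such
  that $W_{n+1}$ contains $N(W_n)$ and, in each component \<open>C\<close> of $G - W_n$, the set
  $W_{n+1} \cap C$ is spanned by a tree which is joined to $W_n$ by a single edge. These trees and
  edges form a spanning tree of $G$. An undominated end lives in exactly one component $C_n$ of
  $G - W_n$ for each \<open>n\<close>, and the $C_n$ have empty intersection; so a rooted ray of the tree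
  belongs to this end if and only if it uses the edges entering all the $C_n$, and there is exactly
  one such ray.
\<close>

section \<open>Components after deleting a vertex set\<close>

text \<open>Requiring the start to avoid \<open>X\<close> too makes this an equivalence relation on
  \<open>vertices G - X\<close>; its classes are the components.\<close>

definition linked :: "'a sgraph \<Rightarrow> 'a set \<Rightarrow> 'a \<Rightarrow> 'a \<Rightarrow> bool" where
  "linked G X u v \<longleftrightarrow> u \<in> vertices G - X \<and> reach_avoiding G X u v"

lemma linked_refl: "u \<in> vertices G - X \<Longrightarrow> linked G X u u"
  by (simp add: linked_def reach_avoiding_def)

lemma linked_step:
  "linked G X u v \<Longrightarrow> adjacent G v w \<Longrightarrow> w \<in> vertices G - X \<Longrightarrow> linked G X u w"
  unfolding linked_def reach_avoiding_def
  by (intro conjI, blast) (rule rtranclp.rtrancl_into_rtrancl, auto)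

lemma linked_left: "linked G X u v \<Longrightarrow> u \<in> vertices G - X"
  by (simp add: linked_def)

lemma linked_induct [consumes 1, case_names base step]:
  assumes "linked G X u v" "u \<in> vertices G - X \<Longrightarrow> P u"
    and "\<And>v w. linked G X u v \<Longrightarrow> adjacent G v w \<Longrightarrow> w \<in> vertices G - X \<Longrightarrow> P v \<Longrightarrow> P w"
  shows "P v"
proof -
  have "(\<lambda>u v. adjacent G u v \<and> v \<in> vertices G - X)\<^sup>*\<^sup>* u v" and u: "u \<in> vertices G - X"
    using assms(1) by (auto simp: linked_def reach_avoiding_def)
  then have "linked G X u v \<and> P v"
  proof (induction rule: rtranclp_induct)
    case base
    show ?case using assms(2) u by (simp add: linked_refl)
  next
    case (step v w)
    then show ?case using assms(3)[of v w] linked_step[of G X u v w] by simp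
  qed
  then show ?thesis by blast
qed

lemma linked_right: "linked G X u v \<Longrightarrow> v \<in> vertices G - X"
  by (induction rule: linked_induct) auto

lemma linked_trans: "linked G X u v \<Longrightarrow> linked G X v w \<Longrightarrow> linked G X u w"
  unfolding linked_def reach_avoiding_def using rtranclp_trans by fast

lemma linked_sym: "linked G X u v \<Longrightarrow> linked G X v u"
proof (induction rule: linked_induct)
  case (step v w)
  have "linked G X w v"
    using linked_step[OF linked_refl[OF step(3)]] linked_right[OF step(1)] step(2)
    by (simp add: adjacent_commute)
  with step show ?case by (blast intro: linked_trans)
qed (rule linked_refl)

lemma linked_mono: "linked G Y u v \<Longrightarrow> X \<inter> vertices G \<subseteq> Y \<Longrightarrow> linked G X u v"
proof (induction rule: linked_induct)
  case base
  then show ?case by (auto intro: linked_refl)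
next
  case (step v w)
  then have "linked G X u v" "w \<in> vertices G - X" by auto
  with step(2) show ?case by (blast intro: linked_step)
qed

lemma linked_imp_path:
  "linked G X u v \<Longrightarrow> \<exists>p. fin_path G p \<and> hd p = u \<and> last p = v \<and> set p \<inter> X = {}"
  by (simp add: linked_def reach_imp_fin_path)

lemma path_imp_linked:
  assumes "fin_path G p" "set p \<inter> X = {}"
  shows "linked G X (hd p) (last p)"
proof -
  have "hd p \<in> set p" "set p \<subseteq> vertices G"
    using assms(1) by (auto simp: fin_path_def)
  then show ?thesis
    using assms by (auto simp: linked_def fin_path_imp_reach)
qed

section \<open>The component in which an end lives\<close>

text \<open>For a finite set \<open>X\<close> and a ray \<open>R\<close> of an end \<open>\<epsilon>\<close> this is the component $C(X, \epsilon)$ of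
  $G - X$ in which \<open>\<epsilon>\<close> lives. If \<open>X\<close> is infinite and \<open>R\<close> has no tail in one component of
  $G - X$, it is empty.\<close>

definition home :: "'a sgraph \<Rightarrow> 'a set \<Rightarrow> (nat \<Rightarrow> 'a) \<Rightarrow> 'a set" where
  "home G X R = {u. \<exists>N. \<forall>n\<ge>N. linked G X (R n) u}"

lemma homeI: "(\<And>n. N \<le> n \<Longrightarrow> linked G X (R n) u) \<Longrightarrow> u \<in> home G X R"
  by (auto simp: home_def)

lemma homeE:
  assumes "u \<in> home G X R"
  obtains N where "\<And>n. N \<le> n \<Longrightarrow> linked G X (R n) u"
  using assms by (auto simp: home_def)

lemma home_mono: "X \<inter> vertices G \<subseteq> Y \<Longrightarrow> home G Y R \<subseteq> home G X R"
  by (rule subsetI, erule homeE, rule homeI) (blast intro: linked_mono)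

lemma home_in:
  assumes "u \<in> home G X R" shows "u \<in> vertices G - X"
proof -
  obtain N where "\<And>n. N \<le> n \<Longrightarrow> linked G X (R n) u"
    using assms homeE by metis
  then show ?thesis using linked_right order_refl by metis
qed

lemma home_linked:
  assumes "u \<in> home G X R" "linked G X u v" shows "v \<in> home G X R"
  using assms(1) by (rule homeE) (rule homeI, rule linked_trans[OF _ assms(2)])

lemma home_step:
  assumes "u \<in> home G X R" "adjacent G u v" "v \<in> vertices G - X"
  shows "v \<in> home G X R"
  using home_linked[OF assms(1) linked_step[OF linked_refl assms(2,3)]] home_in[OF assms(1)] by blast

lemma linked_in_home:
  assumes "u \<in> home G X R" "v \<in> home G X R"
  shows "linked G X u v"
proof -
  obtain M where M: "\<And>n. M \<le> n \<Longrightarrow> linked G X (R n) u"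
    using assms(1) homeE by metis
  obtain N where "\<And>n. N \<le> n \<Longrightarrow> linked G X (R n) v"
    using assms(2) homeE by metis
  with M have "linked G X (R (max M N)) u" "linked G X (R (max M N)) v"
    by simp_all
  then show ?thesis
    by (blast intro: linked_trans[OF linked_sym])
qed

lemma ray_tail_avoids:
  assumes "ray G R" "finite X"
  shows "\<exists>N. \<forall>n\<ge>N. R n \<notin> X"
proof -
  have "finite (R -` X)"
    using assms by (simp add: ray_def finite_vimageI)
  then obtain N where "\<forall>n \<in> R -` X. n < N"
    using finite_nat_set_iff_bounded by blast
  then show ?thesis
    by (intro exI[of _ N]) (auto simp: not_less[symmetric])
qed

lemma tail_linked:
  assumes "ray G R" "\<And>n. N \<le> n \<Longrightarrow> R n \<notin> X" "N \<le> i" "N \<le> j"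
  shows "linked G X (R i) (R j)"
  using reach_along_ray[OF assms] assms(1,2,3) by (auto simp: linked_def ray_def)

lemma tail_in_home:
  assumes "ray G R" "\<And>n. N \<le> n \<Longrightarrow> R n \<notin> X" "N \<le> n"
  shows "R n \<in> home G X R"
  unfolding home_def using tail_linked[OF assms(1,2) _ assms(3)] by blast

text \<open>Once the initial segments meeting \<open>X\<close> are deleted as well, a path
  witnessing non-separation joins the two tails outside \<open>X\<close>.\<close>

lemma equiv_tail_in_home:
  assumes "(R, S) \<in> ray_equiv G" "finite X"
  shows "\<exists>N. \<forall>n\<ge>N. S n \<in> home G X R"
proof -
  have R: "ray G R" and S: "ray G S"
    using assms(1) by (auto simp: ray_equiv_def)
  obtain M N where M: "\<And>n. M \<le> n \<Longrightarrow> R n \<notin> X" and N: "\<And>n. N \<le> n \<Longrightarrow> S n \<notin> X"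
    using ray_tail_avoids[OF R assms(2)] ray_tail_avoids[OF S assms(2)] by blast
  \<comment> \<open>\<open>ray_equiv\<close> only considers separators inside
    \<open>vertices G\<close>, hence the intersection.\<close>
  define Y where "Y = X \<inter> vertices G \<union> R ` {..<M} \<union> S ` {..<N}"
  have "finite Y" "Y \<subseteq> vertices G"
    using R S assms(2) by (auto simp: Y_def ray_def)
  then have "\<not> separates G Y (range R) (range S)"
    using assms(1) by (auto simp: ray_equiv_def)
  then obtain p i j where p: "fin_path G p" "hd p = R i" "last p = S j" "set p \<inter> Y = {}"
    unfolding separates_def by blast
  have l: "linked G Y (R i) (S j)"
    using path_imp_linked[OF p(1,4)] p by simp
  have "M \<le> i" "N \<le> j"
    using linked_left[OF l] linked_right[OF l] by (auto simp: Y_def not_less[symmetric])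
  moreover have "linked G X (R i) (S j)"
    using l by (rule linked_mono) (auto simp: Y_def)
  moreover have "R i \<in> home G X R"
    using tail_in_home[OF R M] \<open>M \<le> i\<close> by blast
  ultimately have "S n \<in> home G X R" if "N \<le> n" for n
    using that tail_linked[OF S N] home_linked by metis
  then show ?thesis by blast
qed

section \<open>Escapable sets and undominated ends\<close>

definition escapes :: "'a sgraph \<Rightarrow> (nat \<Rightarrow> 'a) \<Rightarrow> 'a set \<Rightarrow> bool" where
  "escapes G R U \<longleftrightarrow> (\<exists>X. finite X \<and> home G X R \<inter> U = {})"

text \<open>Absence of domination in the form used below: a finite set separates \<open>v\<close>
  from the end. As \<open>home G Y R\<close> never meets \<open>Y\<close>, the condition
  \<open>v \<notin> Y\<close> is what gives this content.\<close>

definition undominated :: "'a sgraph \<Rightarrow> (nat \<Rightarrow> 'a) \<Rightarrow> bool" where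
  "undominated G R \<longleftrightarrow>
     ray G R \<and> (\<forall>v\<in>vertices G. \<exists>Y. finite Y \<and> v \<notin> Y \<and> v \<notin> home G Y R)"

text \<open>The paths are chosen one after another: the vertices other than \<open>v\<close> on
  earlier paths form a finite set, and deleting it leaves \<open>v\<close> linked to a tail of the
  ray.\<close>

lemma dominating_star:
  assumes R: "ray G R" and v: "\<And>Y. finite Y \<Longrightarrow> v \<notin> Y \<Longrightarrow> v \<in> home G Y R"
  shows "\<exists>P. subdivided_star G v P \<and> (\<forall>i. last (P i) \<in> range R)"
proof -
  define good where "good F p \<longleftrightarrow> fin_path G p \<and> hd p = v \<and> 2 \<le> length p \<and>
    last p \<in> range R \<and> set p \<inter> (F - {v}) = {}" for F p
  have ex: "\<exists>p. good F p" if "finite F" for F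
  proof -
    have "v \<in> home G (F - {v}) R"
      using v that by simp
    then obtain N where N: "\<And>n. N \<le> n \<Longrightarrow> linked G (F - {v}) (R n) v"
      using homeE by metis
    \<comment> \<open>Of two consecutive ray vertices one differs from \<open>v\<close>; aiming at
      it makes the path nontrivial.\<close>
    have "R N \<noteq> R (Suc N)"
      using R by (auto simp: ray_def dest: injD)
    then obtain n where n: "N \<le> n" "R n \<noteq> v"
      by (metis le_SucI order_refl)
    obtain p where p: "fin_path G p" "hd p = v" "last p = R n" "set p \<inter> (F - {v}) = {}"
      using linked_imp_path[OF linked_sym[OF N[OF n(1)]]] by blast
    have "2 \<le> length p"
    proof (rule ccontr)
      assume "\<not> 2 \<le> length p"
      then have "length p = 1"
        using p(1) by (cases p) (auto simp: fin_path_def not_le less_Suc_eq_0_disj)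
      then show False
        using p(2,3) n(2) by (cases p) auto
    qed
    with p show ?thesis unfolding good_def by blast
  qed
  define f where "f F = (SOME p. good F p)" for F
  \<comment> \<open>\<open>F n\<close> collects the vertices of the first \<open>n\<close> chosen
    paths.\<close>
  define F where "F = rec_nat {} (\<lambda>_ F. F \<union> set (f F))"
  have F_Suc: "F (Suc n) = F n \<union> set (f (F n))" for n
    by (simp add: F_def)
  have "finite (F n)" for n
    by (induction n) (simp_all add: F_Suc, simp add: F_def)
  then have good: "good (F n) (f (F n))" for n
    unfolding f_def by (rule someI_ex[OF ex])
  have "F i \<subseteq> F j" if "i \<le> j" for i j
    using that by (rule lift_Suc_mono_le[rotated]) (auto simp: F_Suc)
  then have sub: "set (f (F i)) \<subseteq> F j" if "i < j" for i j
    using that F_Suc[of i] by (metis Suc_leI Un_subset_iff subset_trans)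
  have v_in: "v \<in> set (f (F i))" for i
    using good[of i] unfolding good_def fin_path_def by (metis hd_in_set)
  have lt: "set (f (F i)) \<inter> set (f (F j)) = {v}" if "i < j" for i j
    using sub[OF that] good[of j] v_in unfolding good_def by blast
  have "set (f (F i)) \<inter> set (f (F j)) = {v}" if "i \<noteq> j" for i j
    using lt[of i j] lt[of j i] that by (cases "i < j") (auto simp: Int_commute)
  with good show ?thesis
    unfolding subdivided_star_def good_def by (intro exI[of _ "\<lambda>i. f (F i)"]) blast
qed

lemma topological_end_undominated:
  assumes "\<epsilon> \<in> topological_ends G" "R \<in> \<epsilon>"
  shows "undominated G R"
proof -
  have "\<epsilon> \<in> ends G" and nd: "\<And>v. v \<in> vertices G \<Longrightarrow> \<not> dominates_end G v \<epsilon>"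
    using assms(1) by (auto simp: topological_ends_def)
  then have "ray G R"
    using in_quotient_imp_subset[OF equiv_ray_equiv] assms(2) unfolding ends_def by blast
  then show ?thesis
    using dominating_star[of G R] nd assms(2) unfolding undominated_def dominates_end_def by metis
qed

lemma escapes_singleton:
  assumes "undominated G R" shows "escapes G R {r}"
proof (cases "r \<in> vertices G")
  case False
  then show ?thesis unfolding escapes_def by (intro exI[of _ "{}"]) (auto dest: home_in)
next
  case True
  then show ?thesis using assms unfolding escapes_def undominated_def by blast
qed

definition nbrs :: "'a sgraph \<Rightarrow> 'a set \<Rightarrow> 'a set" where
  "nbrs G W = {u \<in> vertices G. \<exists>w\<in>W. adjacent G w u}"

text \<open>A vertex of \<open>W\<close> adjacent to \<open>home G X R\<close> must lie in
  \<open>X\<close>. Deleting a finite separator \<open>Y x\<close> for each such \<open>x\<close> in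
  \<open>X\<close> keeps the new home away from the neighbours of \<open>x\<close>.\<close>

lemma escapes_nbrs:
  assumes R: "undominated G R" and W: "W \<subseteq> vertices G" "escapes G R W"
  shows "escapes G R (W \<union> nbrs G W)"
proof -
  obtain X where X: "finite X" "home G X R \<inter> W = {}"
    using W(2) by (auto simp: escapes_def)
  have "\<forall>x\<in>X \<inter> vertices G. \<exists>Y. finite Y \<and> x \<notin> Y \<and> x \<notin> home G Y R"
    using R by (auto simp: undominated_def)
  then obtain Y where Y: "\<And>x. x \<in> X \<inter> vertices G \<Longrightarrow> finite (Y x) \<and> x \<notin> Y x \<and> x \<notin> home G (Y x) R"
    by metis
  define Z where "Z = X \<union> (\<Union>x\<in>X \<inter> vertices G. Y x)"
  have "finite Z"
    using X Y by (simp add: Z_def)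
  moreover have "home G Z R \<inter> (W \<union> nbrs G W) = {}"
  proof (rule ccontr)
    assume "home G Z R \<inter> (W \<union> nbrs G W) \<noteq> {}"
    moreover have ZX: "home G Z R \<subseteq> home G X R"
      by (rule home_mono) (auto simp: Z_def)
    ultimately obtain u w where u: "u \<in> home G Z R" "w \<in> W" "adjacent G u w"
      using X by (auto simp: nbrs_def adjacent_commute)
    then have "w \<in> X \<inter> vertices G"
      using ZX home_step[of u G X R w] X(2) W(1) by auto
    then have "u \<in> home G (Y w) R"
      using u(1) home_mono[of "Y w" G Z R] by (auto simp: Z_def)
    then have "w \<in> home G (Y w) R"
      using u(3) Y[of w] \<open>w \<in> X \<inter> vertices G\<close> by (auto intro: home_step)
    then show False
      using Y \<open>w \<in> X \<inter> vertices G\<close> by blast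
  qed
  ultimately show ?thesis unfolding escapes_def by blast
qed

text \<open>Following the parents \<open>p\<close> from a vertex outside \<open>W\<close> leads, inside its component of $G - W$, to
  the only vertex of this component whose parent lies in \<open>W\<close>. The rank \<open>d\<close> witnesses termination.\<close>

definition forest :: "'a sgraph \<Rightarrow> 'a set \<Rightarrow> ('a \<Rightarrow> 'a) \<Rightarrow> ('a \<Rightarrow> nat) \<Rightarrow> bool" where
  "forest G W p d \<longleftrightarrow>
     (\<forall>v \<in> vertices G - W. p v \<in> vertices G \<and> adjacent G v (p v) \<and> (p v \<in> W \<or> d (p v) < d v)) \<and>
     (\<forall>u v. linked G W u v \<and> p u \<in> W \<and> p v \<in> W \<longrightarrow> u = v)"

lemma connected_linked:
  assumes "connected_graph G" "u \<in> vertices G" "v \<in> vertices G"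
  shows "linked G {} u v"
proof -
  obtain p where "fin_path G p" "hd p = u" "last p = v"
    using assms unfolding connected_graph_def by blast
  then show ?thesis
    using path_imp_linked[of G p "{}"] by simp
qed

text \<open>If no vertex of the component of \<open>v\<close> had a neighbour in \<open>W\<close>, a
  path of \<open>G\<close> from \<open>v\<close> to \<open>W\<close> could never leave this
  component.\<close>

lemma boundary_vertex:
  assumes "connected_graph G" "W \<noteq> {}" "W \<subseteq> vertices G" "v \<in> vertices G - W"
  shows "\<exists>c w. linked G W v c \<and> w \<in> W \<and> adjacent G c w"
proof (rule ccontr)
  assume none: "\<not> ?thesis"
  obtain w where w: "w \<in> W" using assms(2) by blast
  have "linked G {} v w"
    using assms w by (intro connected_linked) auto
  then have "linked G W v w"
  proof (induction rule: linked_induct)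
    case base
    show ?case using assms(4) by (rule linked_refl)
  next
    case (step a b)
    then have "b \<notin> W" using none by blast
    then show ?case using linked_step[of G W v a b] step by simp
  qed
  then show False using linked_right[of G W v w] w by blast
qed

text \<open>Each component of G - W gets a breadth-first tree from a vertex adjacent to
  \<open>W\<close>; that vertex is sent into \<open>W\<close>, and the rank is the distance from
  it.\<close>

lemma forest_exists:
  assumes G: "connected_graph G" and W: "W \<noteq> {}" "W \<subseteq> vertices G"
  shows "\<exists>p d. forest G W p d"
proof -
  \<comment> \<open>Linked vertices yield the same predicate under \<open>SOME\<close>, so a
    component receives a single root.\<close>
  define root where "root v = (SOME c. linked G W v c \<and> (\<exists>w\<in>W. adjacent G c w))" for v
  define E where "E = (\<lambda>u v. adjacent G u v \<and> v \<in> vertices G - W)"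
  define d where "d v = (LEAST k. (E ^^ k) (root v) v)" for v
  define q where "q v = (SOME u. if v = root v then u \<in> W \<and> adjacent G v u
    else adjacent G v u \<and> u \<in> vertices G - W \<and> d u < d v)" for v
  have root: "linked G W v (root v) \<and> (\<exists>w\<in>W. adjacent G (root v) w)" if "v \<in> vertices G - W" for v
    unfolding root_def by (rule someI_ex) (use boundary_vertex[OF G W that] in blast)
  have root_eq: "root u = root v" if "linked G W u v" for u v
  proof -
    have "linked G W u c \<longleftrightarrow> linked G W v c" for c
      using that linked_trans linked_sym by metis
    then show ?thesis by (simp add: root_def)
  qed
  have dist: "(E ^^ d v) (root v) v" if "v \<in> vertices G - W" for v
  proof -
    have "E\<^sup>*\<^sup>* (root v) v"
      using linked_sym[of G W v "root v"] root[OF that]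
      by (simp add: linked_def reach_avoiding_def E_def)
    then obtain k where "(E ^^ k) (root v) v"
      using rtranclp_imp_relpowp by metis
    then show ?thesis
      unfolding d_def by (rule LeastI)
  qed
  have q: "if v = root v then q v \<in> W \<and> adjacent G v (q v)
    else adjacent G v (q v) \<and> q v \<in> vertices G - W \<and> d (q v) < d v" if v: "v \<in> vertices G - W" for v
  proof (cases "v = root v")
    case True
    with root[OF v] have "\<exists>u. u \<in> W \<and> adjacent G v u" by metis
    then show ?thesis unfolding q_def if_P[OF True] by (rule someI_ex)
  next
    case False
    then obtain k where k: "d v = Suc k"
      using dist[OF v] by (cases "d v") auto
    \<comment> \<open>The penultimate vertex of a shortest walk from the root serves as
      parent.\<close>
    then obtain u where u: "(E ^^ k) (root v) u" "E u v"
      using dist[OF v] by auto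
    have "reach_avoiding G W (root v) u"
      using relpowp_imp_rtranclp[OF u(1)] by (simp add: reach_avoiding_def E_def)
    then have vu: "linked G W (root v) u"
      using root[OF v] linked_right[of G W v "root v"] by (simp add: linked_def[of _ _ _ u])
    then have "root v = root u"
      using root_eq linked_trans[of G W v "root v" u] root[OF v] by blast
    then have "d u \<le> k"
      unfolding d_def[of u] using u(1) by (simp add: Least_le)
    then have "adjacent G v u \<and> u \<in> vertices G - W \<and> d u < d v"
      using k u(2) linked_right[OF vu] by (auto simp: E_def adjacent_commute)
    then show ?thesis
      unfolding q_def if_not_P[OF False] by (rule someI)
  qed
  have "u = v" if "linked G W u v" "q u \<in> W" "q v \<in> W" for u v
    using q[OF linked_left[OF that(1)]] q[OF linked_right[OF that(1)]] root_eq[OF that(1)] that(2,3)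
    by (auto split: if_splits)
  moreover have "q v \<in> vertices G \<and> adjacent G v (q v) \<and> (q v \<in> W \<or> d (q v) < d v)"
    if "v \<in> vertices G - W" for v
    using q[OF that] W(2) by (auto split: if_splits)
  ultimately show ?thesis unfolding forest_def by blast
qed

text \<open>The parent paths stop before \<open>W\<close>, since \<open>forest\<close> does not
  constrain \<open>p\<close> on \<open>W\<close>.\<close>

definition hull :: "('a \<Rightarrow> 'a) \<Rightarrow> 'a set \<Rightarrow> 'a set \<Rightarrow> 'a set" where
  "hull p W U = {(p ^^ k) u | k u. u \<in> U \<and> (\<forall>i\<le>k. (p ^^ i) u \<notin> W)}"

lemma forestD:
  assumes "forest G W p d" "v \<in> vertices G - W"
  shows "p v \<in> vertices G" "adjacent G v (p v)" "p v \<notin> W \<Longrightarrow> d (p v) < d v"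
  using assms by (auto simp: forest_def)

lemma forest_root_unique:
  "forest G W p d \<Longrightarrow> linked G W u v \<Longrightarrow> p u \<in> W \<Longrightarrow> p v \<in> W \<Longrightarrow> u = v"
  by (simp add: forest_def)

text \<open>A parent path from \<open>U\<close> into \<open>home G X R\<close> must pass through
  \<open>X\<close>, so its later vertices lie on the parent path of some \<open>x\<close> in
  \<open>X\<close>. These finitely many paths are finite and can be deleted too.\<close>

lemma escapes_hull:
  assumes f: "forest G W p d" and U: "U \<subseteq> vertices G" "escapes G R U"
  shows "escapes G R (hull p W U)"
proof -
  obtain X where X: "finite X" "home G X R \<inter> U = {}"
    using U(2) by (auto simp: escapes_def)
  \<comment> \<open>Each step outside \<open>W\<close> lowers the rank, so \<open>d x\<close> steps
    cover the whole path from \<open>x\<close> up to \<open>W\<close>.\<close>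
  define Y where "Y = X \<union> (\<Union>x\<in>X. (\<lambda>j. (p ^^ j) x) ` {..d x})"
  have inV: "(p ^^ i) u \<in> vertices G \<and> d ((p ^^ i) u) + i \<le> d u"
    if "u \<in> vertices G" "\<forall>j\<le>i. (p ^^ j) u \<notin> W" for u i
    using that(2)
  proof (induction i)
    case 0
    then show ?case using that(1) by simp
  next
    case (Suc i)
    then have "(p ^^ i) u \<in> vertices G - W" "(p ^^ Suc i) u \<notin> W" "d ((p ^^ i) u) + i \<le> d u"
      by auto
    then show ?case
      using forestD[OF f, of "(p ^^ i) u"] by simp
  qed
  have "finite Y"
    using X by (simp add: Y_def)
  moreover have "home G Y R \<inter> hull p W U = {}"
  proof (rule ccontr)
    assume "home G Y R \<inter> hull p W U \<noteq> {}"
    then obtain k u where u: "(p ^^ k) u \<in> home G Y R" "u \<in> U" "\<forall>i\<le>k. (p ^^ i) u \<notin> W"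
      unfolding hull_def by blast
    have V: "(p ^^ i) u \<in> vertices G - W" if "i \<le> k" for i
      using inV[of u i] u(2,3) U(1) that by auto
    \<comment> \<open>The path is traversed backwards towards \<open>u\<close>: meeting
      \<open>X\<close> on the way would put the starting point \<open>(p ^^ k) u\<close> into
      \<open>Y\<close>.\<close>
    have "(p ^^ (k - i)) u \<in> home G X R" if "i \<le> k" for i
      using that
    proof (induction i)
      case 0
      then show ?case using u(1) home_mono[of X G Y R] by (auto simp: Y_def)
    next
      case (Suc i)
      let ?x = "(p ^^ (k - Suc i)) u"
      have "k - i = Suc (k - Suc i)"
        using Suc.prems by simp
      then have px: "p ?x = (p ^^ (k - i)) u"
        by simp
      have "?x \<notin> X"
      proof
        assume "?x \<in> X"
        have *: "(p ^^ j) ?x = (p ^^ (j + (k - Suc i))) u" for j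
          by (simp add: funpow_add)
        have "\<forall>j\<le>Suc i. (p ^^ j) ?x \<notin> W"
          unfolding * using u(3) Suc.prems by auto
        then have "Suc i \<le> d ?x"
          using inV[of ?x "Suc i"] V[of "k - Suc i"] by auto
        moreover have "(p ^^ k) u = (p ^^ Suc i) ?x"
          unfolding * using Suc.prems by simp
        ultimately have "(p ^^ k) u \<in> (\<lambda>j. (p ^^ j) ?x) ` {..d ?x}"
          by (intro image_eqI[of _ _ "Suc i"]) auto
        then have "(p ^^ k) u \<in> Y"
          unfolding Y_def using \<open>?x \<in> X\<close> by (intro UnI2 UN_I)
        then show False using home_in[OF u(1)] by blast
      qed
      moreover have "adjacent G (p ?x) ?x" "?x \<in> vertices G"
        using forestD(2)[OF f V[of "k - Suc i"]] V[of "k - Suc i"]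
        by (simp_all add: adjacent_commute)
      ultimately show ?case
        using home_step[of "p ?x" G X R ?x] Suc by (simp add: px)
    qed
    from this[of k] show False using X(2) u(2) by auto
  qed
  ultimately show ?thesis unfolding escapes_def by blast
qed

lemma escapes_subset: "escapes G R U \<Longrightarrow> V \<subseteq> U \<Longrightarrow> escapes G R V"
  unfolding escapes_def by blast

lemma escapes_Un:
  assumes "escapes G R U" "escapes G R V"
  shows "escapes G R (U \<union> V)"
proof -
  obtain X Y where "finite X" "home G X R \<inter> U = {}" "finite Y" "home G Y R \<inter> V = {}"
    using assms by (auto simp: escapes_def)
  moreover have "home G (X \<union> Y) R \<subseteq> home G X R" "home G (X \<union> Y) R \<subseteq> home G Y R"
    by (auto intro!: home_mono)
  ultimately show ?thesis
    unfolding escapes_def by (intro exI[of _ "X \<union> Y"]) blast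
qed

text \<open>Although \<open>W\<close> may be infinite, a home disjoint from it is connected in G - W
  and contains tails of both rays.\<close>

lemma escapes_tails_linked:
  assumes e: "escapes G R W" and RS: "(R, S) \<in> ray_equiv G"
  shows "\<exists>N. \<forall>m\<ge>N. \<forall>n\<ge>N. linked G W (R m) (S n)"
proof -
  obtain X where X: "finite X" "home G X R \<inter> W = {}"
    using e by (auto simp: escapes_def)
  have R: "ray G R" using RS by (simp add: ray_equiv_def)
  have conn: "linked G W u v" if u: "u \<in> home G X R" and v: "v \<in> home G X R" for u v
    using linked_in_home[OF u v]
  proof (induction rule: linked_induct)
    case base
    have "u \<in> vertices G - W"
      using home_in[OF u] u X(2) by blast
    then show ?case by (rule linked_refl)
  next
    case (step v w)
    have "w \<in> home G X R"
      by (rule home_linked[OF u linked_step[OF step(1-3)]])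
    then have "w \<in> vertices G - W"
      using step(3) X(2) by blast
    with step(4,2) show ?case by (rule linked_step)
  qed
  obtain L where L: "\<And>n. L \<le> n \<Longrightarrow> R n \<notin> X"
    using ray_tail_avoids[OF R X(1)] by blast
  obtain N where N: "\<And>n. N \<le> n \<Longrightarrow> S n \<in> home G X R"
    using equiv_tail_in_home[OF RS X(1)] by blast
  show ?thesis
    using conn[OF tail_in_home[OF R L] N] by (intro exI[of _ "max L N"]) simp
qed

text \<open>This keeps the parent chains of a new layer inside that layer until they reach
  \<open>W\<close>.\<close>

lemma hull_layer:
  assumes f: "forest G W p d" and x: "x \<in> hull p W (nbrs G W)"
  shows "x \<in> vertices G - W" "p x \<in> W \<union> hull p W (nbrs G W)"
proof -
  obtain k u where u: "x = (p ^^ k) u" "u \<in> nbrs G W" "\<forall>i\<le>k. (p ^^ i) u \<notin> W"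
    using x by (auto simp: hull_def)
  have "(p ^^ i) u \<in> vertices G - W" if "i \<le> k" for i
    using that
  proof (induction i)
    case 0
    then show ?case using u(2,3) by (auto simp: nbrs_def)
  next
    case (Suc i)
    then show ?case using forestD(1)[OF f, of "(p ^^ i) u"] u(3) by auto
  qed
  then show "x \<in> vertices G - W" using u(1) by blast
  show "p x \<in> W \<union> hull p W (nbrs G W)"
  proof (cases "p x \<in> W")
    case False
    then have "p x = (p ^^ Suc k) u" "\<forall>i\<le>Suc k. (p ^^ i) u \<notin> W"
      using u by (auto simp: le_Suc_eq)
    then show ?thesis
      using u(2) unfolding hull_def by blast
  qed simp
qed

lemma nbrs_hull: "u \<in> nbrs G W \<Longrightarrow> u \<in> W \<union> hull p W (nbrs G W)"
  unfolding hull_def by (auto intro!: exI[of _ 0])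

section \<open>Spanning trees given by a parent function\<close>

locale rooted_tree =
  fixes G :: "'a sgraph" and r :: 'a and par :: "'a \<Rightarrow> 'a"
  assumes simple: "simple_graph G"
    and root_in: "r \<in> vertices G"
    and par_root: "par r = r"
    and par_adj: "v \<in> vertices G \<Longrightarrow> v \<noteq> r \<Longrightarrow> par v \<in> vertices G \<and> adjacent G v (par v)"
    and reaches_root: "v \<in> vertices G \<Longrightarrow> \<exists>k. (par ^^ k) v = r"
begin

definition height :: "'a \<Rightarrow> nat" where
  "height v = (LEAST k. (par ^^ k) v = r)"

definition tree :: "'a sgraph" where
  "tree = \<lparr>vertices = vertices G, edges = {{v, par v} | v. v \<in> vertices G - {r}}\<rparr>"

lemma height_root: "height r = 0"
  by (simp add: height_def)

lemma height_par:
  assumes "v \<in> vertices G" "v \<noteq> r"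
  shows "height v = Suc (height (par v))"
proof -
  obtain k where "(par ^^ k) v = r"
    using reaches_root[OF assms(1)] by blast
  then have "(LEAST k. (par ^^ k) v = r) = Suc (LEAST k. (par ^^ Suc k) v = r)"
    using assms(2) by (intro Least_Suc) auto
  then show ?thesis
    by (simp add: height_def funpow_swap1)
qed

lemma height_0: "v \<in> vertices G \<Longrightarrow> height v = 0 \<Longrightarrow> v = r"
  using height_par by force

lemma par_in: "v \<in> vertices G \<Longrightarrow> par v \<in> vertices G"
  using par_adj par_root by (cases "v = r") auto

lemma par_pow_in: "v \<in> vertices G \<Longrightarrow> (par ^^ k) v \<in> vertices G"
  by (induction k) (auto intro: par_in)

lemma height_pow: "v \<in> vertices G \<Longrightarrow> height ((par ^^ k) v) = height v - k"
proof (induction k)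
  case (Suc k)
  then show ?case
    using height_par[OF par_pow_in[of v k]] par_root height_root
    by (cases "(par ^^ k) v = r") auto
qed simp

lemma tree_adj:
  "adjacent tree u v \<longleftrightarrow> (u \<in> vertices G - {r} \<and> v = par u) \<or> (v \<in> vertices G - {r} \<and> u = par v)"
  unfolding adjacent_def tree_def by (auto simp: doubleton_eq_iff)

lemma vertices_tree: "vertices tree = vertices G"
  by (simp add: tree_def)

lemma tree_linked_root:
  assumes "v \<in> vertices G"
  shows "linked tree {} v r"
  using assms
proof (induction "height v" arbitrary: v)
  case 0
  then show ?case using height_0[of v] by (auto intro!: linked_refl simp: vertices_tree)
next
  case (Suc k)
  then have v: "v \<noteq> r" using height_root by auto
  then have "linked tree {} (par v) r"
    using Suc height_par[of v] par_in by simp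
  moreover have "linked tree {} v (par v)"
    using Suc v par_in[of v]
    by (intro linked_step[OF linked_refl]) (auto simp: vertices_tree tree_adj)
  ultimately show ?case by (blast intro: linked_trans)
qed

text \<open>Both cyclic neighbours of a vertex of maximal height would be its parent, but on a cycle
  of length at least 3 they are distinct.\<close>

lemma no_cycle: "\<not> cycle_in tree c"
proof
  assume "cycle_in tree c"
  then have c: "c \<noteq> []" "distinct c" "set c \<subseteq> vertices G" "successively (adjacent tree) c"
    "3 \<le> length c" "adjacent tree (last c) (hd c)"
    by (auto simp: cycle_in_def fin_path_def vertices_tree)
  let ?n = "length c"
  have adj: "adjacent tree (c ! i) (c ! (Suc i mod ?n))" if "i < ?n" for i
  proof (cases "Suc i = ?n")
    case True
    then have "i = ?n - 1" by simp
    then show ?thesis using c True by (simp add: last_conv_nth hd_conv_nth)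
  next
    case False
    then show ?thesis using c(4) that by (simp add: successively_conv_nth)
  qed
  have "finite (height ` set c)" "height ` set c \<noteq> {}"
    using c(1) by auto
  then have "Max (height ` set c) \<in> height ` set c"
    by (rule Max_in)
  then obtain x where x: "Max (height ` set c) = height x" "x \<in> set c"
    by (rule imageE)
  obtain i where "i < ?n" "c ! i = x"
    using x(2) unfolding in_set_conv_nth by blast
  with x(1) have i: "i < ?n" "height (c ! i) = Max (height ` set c)"
    by simp_all
  have max: "height (c ! j) \<le> height (c ! i)" if "j < ?n" for j
    using i(2) that by simp
  have par: "c ! j = par (c ! i)" if "j < ?n" "adjacent tree (c ! i) (c ! j)" for j
  proof (rule ccontr)
    assume "c ! j \<noteq> par (c ! i)"
    then have "c ! j \<in> vertices G" "c ! j \<noteq> r" "c ! i = par (c ! j)"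
      using that(2) by (auto simp: tree_adj)
    then show False using height_par[of "c ! j"] max[OF that(1)] by simp
  qed
  \<comment> \<open>The cyclic predecessor of \<open>i\<close>.\<close>
  define j where "j = (if i = 0 then ?n - 1 else i - 1)"
  have j: "j < ?n" "Suc j mod ?n = i"
    using i(1) c(1) by (auto simp: j_def)
  have k: "Suc i mod ?n < ?n"
    using i(1) by (intro mod_less_divisor) linarith
  have "adjacent tree (c ! i) (c ! j)"
    using adj[OF j(1)] unfolding j(2) by (subst adjacent_commute)
  then have "c ! j = c ! (Suc i mod ?n)"
    using par[OF j(1)] par[OF k adj[OF i(1)]] by simp
  then have "j = Suc i mod ?n"
    using c(2) j(1) k by (simp add: nth_eq_iff_index_eq)
  then show False
    using c(5) i(1) by (auto simp: j_def mod_Suc split: if_splits)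
qed

lemma tree_subgraph: "edges tree \<subseteq> edges G"
  using par_adj by (auto simp: tree_def adjacent_def)

lemma spanning: "spanning_tree_of tree G"
proof -
  have "simple_graph tree"
    using simple tree_subgraph by (auto simp: simple_graph_def vertices_tree)
  moreover have "\<exists>p. fin_path tree p \<and> hd p = u \<and> last p = v"
    if "u \<in> vertices G" "v \<in> vertices G" for u v
    using linked_imp_path[OF linked_trans[OF tree_linked_root[OF that(1)]
        linked_sym[OF tree_linked_root[OF that(2)]]]] by blast
  then have "connected_graph tree"
    using root_in by (auto simp: connected_graph_def vertices_tree)
  ultimately show ?thesis
    using tree_subgraph no_cycle by (auto simp: spanning_tree_of_def tree_graph_def vertices_tree)
qed

lemma tree_ray: "ray tree R \<Longrightarrow> ray G R"
  using tree_subgraph by (auto simp: ray_def vertices_tree adjacent_def)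

text \<open>A step to the parent would revisit the preceding vertex, so by injectivity every step
  leads to a child.\<close>

lemma rooted_ray:
  assumes "ray tree R" "R 0 = r"
  shows "R (Suc n) \<noteq> r \<and> par (R (Suc n)) = R n"
proof (induction n)
  case 0
  have "R 1 \<noteq> R 0" using assms(1) by (auto simp: ray_def dest: injD)
  moreover have "adjacent tree (R 0) (R 1)" using assms(1) by (simp add: ray_def)
  ultimately show ?case using assms(2) by (auto simp: tree_adj)
next
  case (Suc n)
  have "R (Suc (Suc n)) \<noteq> R n" "R (Suc (Suc n)) \<noteq> R 0"
    using assms(1) by (auto simp: ray_def dest: injD)
  moreover have "adjacent tree (R (Suc n)) (R (Suc (Suc n)))" using assms(1) by (simp add: ray_def)
  ultimately show ?case using assms(2) Suc by (auto simp: tree_adj)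
qed

text \<open>As \<open>par r = r\<close>, iterates past the root stay there, matching the truncated
  subtraction.\<close>

lemma rooted_ray_pow:
  assumes "ray tree R" "R 0 = r"
  shows "(par ^^ k) (R n) = R (n - k)"
proof (induction k)
  case (Suc k)
  then show ?case
    using rooted_ray[OF assms, of "n - Suc k"] assms(2) par_root
    by (cases "k < n") (simp_all add: Suc_diff_Suc)
qed simp

lemma rooted_ray_height:
  assumes "ray tree R" "R 0 = r"
  shows "height (R n) = n"
proof (induction n)
  case 0
  show ?case using assms(2) height_root by simp
next
  case (Suc n)
  then show ?case
    using rooted_ray[OF assms, of n] height_par[of "R (Suc n)"] assms(1)
    by (auto simp: ray_def vertices_tree)
qed

end

section \<open>The layers and the tree assembled from them\<close>

text \<open>Each forest covers all of G - W n, but only its parent paths from the neighbours of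
  \<open>W n\<close> are kept; the other vertices get their parents from later forests.\<close>

locale layering =
  fixes G :: "'a sgraph" and r :: 'a and W :: "nat \<Rightarrow> 'a set"
    and p :: "nat \<Rightarrow> 'a \<Rightarrow> 'a" and d :: "nat \<Rightarrow> 'a \<Rightarrow> nat"
  assumes simple_G: "simple_graph G" and connected_G: "connected_graph G"
    and r_in: "r \<in> vertices G"
    and W_0: "W 0 = {r}"
    and W_Suc: "W (Suc n) = W n \<union> hull (p n) (W n) (nbrs G (W n))"
    and forest: "forest G (W n) (p n) (d n)"
begin

lemma W_mono: "m \<le> n \<Longrightarrow> W m \<subseteq> W n"
  by (rule lift_Suc_mono_le[of W]) (simp_all add: W_Suc)

lemma W_in: "W n \<subseteq> vertices G"
proof (induction n)
  case (Suc n)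
  then show ?case using hull_layer(1)[OF forest] by (auto simp: W_Suc)
qed (simp add: W_0 r_in)

lemma r_in_W: "r \<in> W n"
  using W_mono[of 0 n] by (simp add: W_0)

lemma nbrs_W: "nbrs G (W n) \<subseteq> W (Suc n)"
  using nbrs_hull[of _ G "W n" "p n"] unfolding W_Suc by (intro subsetI)

lemma W_exhausts: "v \<in> vertices G \<Longrightarrow> \<exists>n. v \<in> W n"
proof -
  assume "v \<in> vertices G"
  then have "linked G {} r v"
    using connected_G r_in by (blast intro: connected_linked)
  then show ?thesis
  proof (induction rule: linked_induct)
    case base
    show ?case using W_0 by blast
  next
    case (step v w)
    then obtain n where "v \<in> W n" by blast
    then have "w \<in> nbrs G (W n)" using step(2,3) by (auto simp: nbrs_def)
    then show ?case using nbrs_W by blast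
  qed
qed

lemma finite_in_W: "finite X \<Longrightarrow> X \<subseteq> vertices G \<Longrightarrow> \<exists>n. X \<subseteq> W n"
proof (induction rule: finite_induct)
  case (insert x X)
  then obtain m n where "X \<subseteq> W m" "x \<in> W n"
    using W_exhausts[of x] by auto
  then show ?case
    using W_mono[of m "max m n"] W_mono[of n "max m n"] by (intro exI[of _ "max m n"]) auto
qed simp

text \<open>For \<open>v \<noteq> r\<close> this is the only \<open>n\<close> with
  \<open>v \<in> W (Suc n) - W n\<close>. The root lies in every layer set, so \<open>par\<close>
  treats it separately.\<close>

definition stage :: "'a \<Rightarrow> nat" where
  "stage v = (LEAST n. v \<in> W (Suc n))"

definition par :: "'a \<Rightarrow> 'a" where
  "par v = (if v = r then r else p (stage v) v)"

lemma stage_eq: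
  assumes "v \<in> W (Suc n) - W n"
  shows "stage v = n"
  unfolding stage_def
proof (rule Least_equality)
  fix m
  assume "v \<in> W (Suc m)"
  then show "n \<le> m" using W_mono[of "Suc m" n] assms by (force simp: not_less_eq_eq[symmetric])
qed (use assms in blast)

lemma stage_in:
  assumes "v \<in> vertices G" "v \<noteq> r"
  shows "v \<in> W (Suc (stage v)) - W (stage v)"
proof -
  obtain n where "v \<in> W n" using W_exhausts[OF assms(1)] by blast
  then have "v \<in> W (Suc n)" using W_mono[of n "Suc n"] by auto
  then have "v \<in> W (Suc (stage v))" unfolding stage_def by (rule LeastI)
  moreover have "v \<notin> W (stage v)"
  proof (cases "stage v")
    case 0
    then show ?thesis using assms(2) by (simp add: W_0)
  next
    case (Suc m)
    then show ?thesis using not_less_Least[of m "\<lambda>n. v \<in> W (Suc n)"] by (simp add: stage_def)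
  qed
  ultimately show ?thesis by blast
qed

lemma par_eq:
  assumes "v \<in> W (Suc n) - W n"
  shows "par v = p n v"
  using assms stage_eq[OF assms] r_in_W[of n] by (auto simp: par_def)

lemma par_layer:
  assumes "v \<in> W (Suc n) - W n"
  shows "par v \<in> W (Suc n)" "adjacent G v (par v)" "par v \<notin> W n \<Longrightarrow> d n (par v) < d n v"
proof -
  have "v \<in> hull (p n) (W n) (nbrs G (W n))"
    using assms by (auto simp: W_Suc)
  then show "par v \<in> W (Suc n)"
    using hull_layer(2)[OF forest] unfolding par_eq[OF assms] W_Suc by blast
  have "v \<in> vertices G - W n" using assms W_in by blast
  from forestD[OF forest this] show "adjacent G v (par v)" "par v \<notin> W n \<Longrightarrow> d n (par v) < d n v"
    unfolding par_eq[OF assms] by blast+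
qed

text \<open>Within one layer the rank decreases along parents until the preceding layer set is
  reached.\<close>

lemma W_reaches_root: "v \<in> W n \<Longrightarrow> \<exists>k. (par ^^ k) v = r"
proof (induction n arbitrary: v)
  case 0
  then show ?case by (intro exI[of _ 0]) (simp add: W_0)
next
  case (Suc n)
  from Suc.prems show ?case
  proof (induction "d n v" arbitrary: v rule: less_induct)
    case less
    show ?case
    proof (cases "v \<in> W n")
      case True
      then show ?thesis by (rule Suc.IH)
    next
      case False
      with less.prems have v: "v \<in> W (Suc n) - W n" by blast
      have "\<exists>k. (par ^^ k) (par v) = r"
        using less.hyps[OF par_layer(3)[OF v] par_layer(1)[OF v]] Suc.IH by blast
      then obtain k where "(par ^^ k) (par v) = r" by blast
      then have "(par ^^ Suc k) v = r" by (simp add: funpow_swap1)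
      then show ?thesis by blast
    qed
  qed
qed

sublocale rooted_tree G r par
proof
  show "simple_graph G" "r \<in> vertices G" "par r = r"
    by (simp_all add: simple_G r_in par_def)
  show "par v \<in> vertices G \<and> adjacent G v (par v)" if "v \<in> vertices G" "v \<noteq> r" for v
    using par_layer[OF stage_in[OF that]] W_in by blast
  show "\<exists>k. (par ^^ k) v = r" if "v \<in> vertices G" for v
    using W_exhausts[OF that] W_reaches_root by blast
qed

section \<open>Undominated ends and rooted rays\<close>

lemma escapes_W:
  assumes "undominated G R"
  shows "escapes G R (W n)"
proof (induction n)
  case 0
  show ?case using escapes_singleton[OF assms] by (simp add: W_0)
next
  case (Suc n)
  then have "escapes G R (nbrs G (W n))"
    using escapes_nbrs[OF assms W_in] escapes_subset by blast
  then have "escapes G R (hull (p n) (W n) (nbrs G (W n)))"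
    by (rule escapes_hull[OF forest, rotated]) (auto simp: nbrs_def)
  with Suc show ?case unfolding W_Suc by (rule escapes_Un)
qed

text \<open>Such a \<open>c\<close> is a neighbour of \<open>W n\<close> and is added at once, so
  its tree parent is the one given by \<open>p n\<close>.\<close>

lemma entrance_layer:
  assumes "c \<in> vertices G - W n" "par c \<in> W n"
  shows "c \<in> W (Suc n) - W n"
proof -
  have "adjacent G (par c) c"
    using par_adj[of c] assms r_in_W[of n] by (auto simp: adjacent_commute)
  then have "c \<in> nbrs G (W n)" using assms by (auto simp: nbrs_def)
  then show ?thesis using nbrs_W assms(1) by blast
qed

lemma entrance_unique:
  assumes "linked G (W n) u v" "par u \<in> W n" "par v \<in> W n"
  shows "u = v"
proof (rule forest_root_unique[OF forest assms(1)])
  show "p n u \<in> W n" "p n v \<in> W n"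
    using par_eq[OF entrance_layer[OF linked_left[OF assms(1)] assms(2)]]
      par_eq[OF entrance_layer[OF linked_right[OF assms(1)] assms(3)]] assms(2,3) by simp_all
qed

text \<open>The parent path of \<open>v\<close> ends at \<open>r\<close>, which lies in
  \<open>W n\<close>; its last vertex before first meeting \<open>W n\<close> is the
  entrance.\<close>

lemma entrance_exists:
  assumes "v \<in> vertices G - W n"
  shows "\<exists>k\<le>height v. par ((par ^^ k) v) \<in> W n \<and> (\<forall>j\<le>k. linked G (W n) v ((par ^^ j) v))"
  using assms
proof (induction "height v" arbitrary: v)
  case 0
  then show ?case using height_0[of v] r_in_W[of n] by auto
next
  case (Suc h)
  have v: "v \<in> vertices G" "v \<noteq> r"
    using Suc.prems r_in_W[of n] by auto
  show ?case
  proof (cases "par v \<in> W n")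
    case True
    then show ?thesis using linked_refl[OF Suc.prems] by (intro exI[of _ 0]) simp
  next
    case False
    have h: "height v = Suc (height (par v))" using height_par[OF v] .
    have "par v \<in> vertices G - W n" using par_in[OF v(1)] False by blast
    moreover from this have vp: "linked G (W n) v (par v)"
      using linked_step[OF linked_refl[OF Suc.prems]] par_adj[OF v] by blast
    ultimately obtain k where k: "k \<le> height (par v)" "par ((par ^^ k) (par v)) \<in> W n"
      "\<forall>j\<le>k. linked G (W n) (par v) ((par ^^ j) (par v))"
      using Suc.hyps(1)[of "par v"] Suc.hyps(2) h by auto
    have "linked G (W n) v ((par ^^ j) v)" if "j \<le> Suc k" for j
    proof (cases j)
      case 0
      then show ?thesis using linked_refl[OF Suc.prems] by simp
    next
      case (Suc i)
      then show ?thesis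
        using linked_trans[OF vp] k(3) that by (simp add: funpow_swap1)
    qed
    then show ?thesis
      using k(1,2) h by (intro exI[of _ "Suc k"]) (simp add: funpow_swap1)
  qed
qed

text \<open>Late vertices of both rays share a component of G - W n. Climbing from them leads to its
  only entrance, up to which the rays must agree.\<close>

lemma rooted_rays_unique:
  assumes R: "ray tree R" "R 0 = r" and S: "ray tree S" "S 0 = r"
    and RS: "(R, S) \<in> ray_equiv G" and und: "undominated G R"
  shows "R = S"
proof
  fix k
  have "R ` {..k} \<subseteq> vertices G"
    using R(1) by (auto simp: ray_def vertices_tree)
  \<comment> \<open>This choice forces the entrance to have index greater than
    \<open>k\<close>.\<close>
  then obtain n where n: "R ` {..k} \<subseteq> W n"
    using finite_in_W[of "R ` {..k}"] by auto
  obtain N where N: "linked G (W n) (R N) (S N)"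
    using escapes_tails_linked[OF escapes_W[OF und] RS] by blast
  obtain a where a: "par (R (N - a)) \<in> W n" "linked G (W n) (R N) (R (N - a))"
    using entrance_exists[OF linked_left[OF N]] by (auto simp: rooted_ray_pow[OF R])
  obtain b where b: "par (S (N - b)) \<in> W n" "linked G (W n) (S N) (S (N - b))"
    using entrance_exists[OF linked_right[OF N]] by (auto simp: rooted_ray_pow[OF S])
  have eq: "R (N - a) = S (N - b)"
    using linked_trans[OF linked_sym[OF a(2)] linked_trans[OF N b(2)]] a(1) b(1)
    by (rule entrance_unique)
  then have same: "N - a = N - b"
    using rooted_ray_height[OF R, of "N - a"] rooted_ray_height[OF S, of "N - b"] by simp
  have "R (N - a) \<notin> W n"
    using linked_right[OF a(2)] by blast
  then have "\<not> N - a \<le> k"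
    using n by auto
  then have "R k = (par ^^ (N - a - k)) (R (N - a))" "S k = (par ^^ (N - a - k)) (S (N - a))"
    by (simp_all add: rooted_ray_pow[OF R] rooted_ray_pow[OF S])
  then show "R k = S k" using eq same by simp
qed

text \<open>The entrances of the nested components containing tails of \<open>R\<close> lie on one
  ascending chain of the tree, which is the required ray.\<close>

lemma rooted_ray_exists:
  assumes und: "undominated G R"
  shows "\<exists>S. ray tree S \<and> S 0 = r \<and> (R, S) \<in> ray_equiv G"
proof -
  have R: "ray G R" using und by (simp add: undominated_def)
  define C where "C n = home G (W n) R" for n
  \<comment> \<open>Since \<open>W n\<close> may be infinite, escapability is needed for
    \<open>C n\<close> to contain a tail.\<close>
  have tail: "\<exists>N. \<forall>m\<ge>N. R m \<in> C n" for n
  proof -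
    have "(R, R) \<in> ray_equiv G"
      using R not_separates_refl by (auto simp: ray_equiv_def)
    then obtain N where "\<And>i j. N \<le> i \<Longrightarrow> N \<le> j \<Longrightarrow> linked G (W n) (R i) (R j)"
      using escapes_tails_linked[OF escapes_W[OF und]] by blast
    then show ?thesis
      unfolding C_def by (intro exI[of _ N] allI impI homeI[of N])
  qed
  have C_mono: "C m \<subseteq> C n" if "n \<le> m" for m n
    unfolding C_def using W_mono[OF that] by (intro home_mono) blast
  have C_in: "v \<in> vertices G - W n" if "v \<in> C n" for v n
    using home_in that by (simp add: C_def)
  have "\<exists>c. c \<in> C n \<and> par c \<in> W n" for n
  proof -
    obtain v where v: "v \<in> C n" using tail by blast
    obtain k where "par ((par ^^ k) v) \<in> W n" "linked G (W n) v ((par ^^ k) v)"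
      using entrance_exists[OF C_in[OF v]] by blast
    then show ?thesis using home_linked[of v G "W n" R] v unfolding C_def by blast
  qed
  then obtain c where c: "\<And>n. c n \<in> C n" "\<And>n. par (c n) \<in> W n" by metis
  have c_in: "c n \<in> vertices G" for n using C_in[OF c(1)] by blast
  \<comment> \<open>Every vertex of \<open>C n\<close> descends from the entrance \<open>c n\<close>
    by a tree path inside \<open>C n\<close>.\<close>
  have anc: "height (c n) \<le> height v \<and> (par ^^ (height v - height (c n))) v = c n \<and>
      (\<forall>j\<le>height v - height (c n). (par ^^ j) v \<in> C n)" if v: "v \<in> C n" for v n
  proof -
    obtain k where k: "k \<le> height v" "par ((par ^^ k) v) \<in> W n"
      "\<And>j. j \<le> k \<Longrightarrow> linked G (W n) v ((par ^^ j) v)"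
      using entrance_exists[OF C_in[OF v]] by blast
    have in_C: "(par ^^ j) v \<in> C n" if "j \<le> k" for j
      using home_linked[OF _ k(3)[OF that]] v by (simp add: C_def)
    then have "linked G (W n) ((par ^^ k) v) (c n)"
      using c(1)[of n] by (auto simp: C_def intro: linked_in_home)
    then have eq: "(par ^^ k) v = c n"
      using k(2) c(2) by (rule entrance_unique)
    then have "height (c n) = height v - k"
      using height_pow[of v k] C_in[OF v] by simp
    then have "k = height v - height (c n)" "height (c n) \<le> height v" using k(1) by auto
    then show ?thesis using eq in_C by simp
  qed
  have c_C: "c m \<in> C n" if "n \<le> m" for m n
    using c(1)[of m] C_mono[OF that] by (rule subsetD[rotated])
  \<comment> \<open>\<open>c n\<close> already lies in \<open>W (Suc n)\<close> and
    \<open>c (Suc n)\<close> does not, so the ancestor is proper.\<close>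
  have step: "height (c n) < height (c (Suc n))" for n
  proof (rule ccontr)
    assume "\<not> ?thesis"
    then have "height (c (Suc n)) - height (c n) = 0"
      by simp
    moreover have "(par ^^ (height (c (Suc n)) - height (c n))) (c (Suc n)) = c n"
      using anc[OF c_C[of n "Suc n"]] by simp
    ultimately have "c (Suc n) = c n"
      by simp
    moreover have "c n \<in> W (Suc n)"
      using entrance_layer[OF C_in[OF c(1)] c(2)] by blast
    ultimately show False using C_in[OF c(1), of "Suc n"] by simp
  qed
  have ge: "n \<le> height (c n)" for n
  proof (induction n)
    case (Suc n)
    then show ?case using step[of n] by simp
  qed simp
  \<comment> \<open>The ancestor of \<open>c k\<close> at height \<open>k\<close>, which exists
    because \<open>k \<le> height (c k)\<close>.\<close>
  define S where "S k = (par ^^ (height (c k) - k)) (c k)" for k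
  have S_eq: "S k = (par ^^ (height (c m) - k)) (c m)" if "k \<le> m" for k m
  proof -
    have a: "height (c k) \<le> height (c m)" "c k = (par ^^ (height (c m) - height (c k))) (c m)"
      using anc[OF c_C[OF that]] by auto
    have "S k = (par ^^ (height (c k) - k)) ((par ^^ (height (c m) - height (c k))) (c m))"
      unfolding S_def by (subst a(2)[symmetric]) (rule refl)
    also have "\<dots> = (par ^^ (height (c k) - k + (height (c m) - height (c k)))) (c m)"
      by (simp add: funpow_add)
    also have "height (c k) - k + (height (c m) - height (c k)) = height (c m) - k"
      using a(1) ge[of k] by simp
    finally show ?thesis .
  qed
  have S_in: "S k \<in> vertices G" for k
    unfolding S_def using par_pow_in[OF c_in] .
  have S_height: "height (S k) = k" for k
    unfolding S_def using height_pow[OF c_in] ge[of k] by simp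
  have S_par: "par (S (Suc k)) = S k" for k
  proof -
    have "height (c (Suc k)) - k = Suc (height (c (Suc k)) - Suc k)"
      using ge[of "Suc k"] by simp
    then show ?thesis using S_eq[of k "Suc k"] by (simp add: S_def)
  qed
  have S_root: "S 0 = r" using height_0[OF S_in S_height] .
  have "inj S" using S_height by (metis injI)
  moreover have "S (Suc k) \<noteq> r" for k
    using S_height[of "Suc k"] height_root by auto
  ultimately have S: "ray tree S"
    using S_in S_par by (auto simp: ray_def vertices_tree tree_adj)
  have S_C: "S k \<in> C n" if "height (c n) \<le> k" for k n
  proof -
    have "height (c (max k n)) - k \<le> height (c (max k n)) - height (c n)"
      using that by simp
    then show ?thesis
      using anc[OF c_C[of n "max k n"]] S_eq[of k "max k n"] by simp
  qed
  have "\<not> separates G X (range R) (range S)" if X: "finite X" "X \<subseteq> vertices G" for X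
  proof -
    \<comment> \<open>Both \<open>R\<close> and \<open>S\<close> have vertices in
      \<open>C n\<close>, which is connected and avoids \<open>W n\<close>, hence
      \<open>X\<close>.\<close>
    obtain n where n: "X \<subseteq> W n" using finite_in_W[OF X] by blast
    obtain m where "R m \<in> C n" using tail by blast
    then have "linked G (W n) (R m) (S (height (c n)))"
      using S_C[of n] by (auto simp: C_def intro: linked_in_home)
    then obtain q where "fin_path G q" "hd q = R m" "last q = S (height (c n))" "set q \<inter> W n = {}"
      using linked_imp_path by metis
    then show ?thesis using n unfolding separates_def by blast
  qed
  then have "(R, S) \<in> ray_equiv G"
    using R tree_ray[OF S] by (auto simp: ray_equiv_def)
  with S S_root show ?thesis by blast
qed

lemma end_faithful: "end_faithful_for tree r (topological_ends G)"
  unfolding end_faithful_for_def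
proof
  fix \<epsilon>
  assume \<epsilon>: "\<epsilon> \<in> topological_ends G"
  then have q: "\<epsilon> \<in> {R. ray G R} // ray_equiv G"
    by (simp add: topological_ends_def ends_def)
  obtain R where R: "R \<in> \<epsilon>"
    using in_quotient_imp_non_empty[OF equiv_ray_equiv q] by blast
  obtain S where S: "ray tree S" "S 0 = r" "(R, S) \<in> ray_equiv G"
    using rooted_ray_exists[OF topological_end_undominated[OF \<epsilon> R]] by blast
  have "S \<in> \<epsilon>"
    using in_quotient_imp_closed[OF equiv_ray_equiv q R S(3)] .
  show "\<exists>!R. ray tree R \<and> R 0 = r \<and> R \<in> \<epsilon>"
  proof (intro ex1I conjI)
    fix Q
    assume Q: "ray tree Q \<and> Q 0 = r \<and> Q \<in> \<epsilon>"
    then have "(Q, S) \<in> ray_equiv G"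
      using in_quotient_imp_in_rel[OF equiv_ray_equiv q] \<open>S \<in> \<epsilon>\<close> by simp
    then show "Q = S"
      using rooted_rays_unique Q S topological_end_undominated[OF \<epsilon>] by blast
  qed fact+
qed

end

section \<open>Existence of the layers and conclusion\<close>

lemma layering_exists:
  fixes G :: "'a sgraph"
  assumes G: "simple_graph G" "connected_graph G" and r: "r \<in> vertices G"
  shows "\<exists>W p d. layering G r W p d"
proof -
  \<comment> \<open>With the condition under the quantifiers, choice gives total functions of
    \<open>W\<close>, so the recursion can be defined before its values are known to be nonempty
    sets of vertices.\<close>
  have "\<forall>W. \<exists>p d. W \<noteq> {} \<and> W \<subseteq> vertices G \<longrightarrow> forest G W p d"
    using forest_exists[OF G(2)] by blast
  then obtain P D where PD: "\<And>W. W \<noteq> {} \<and> W \<subseteq> vertices G \<Longrightarrow> forest G W (P W) (D W)"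
    by metis
  define W where "W = rec_nat {r} (\<lambda>_ W. W \<union> hull (P W) W (nbrs G W))"
  have W_0: "W 0 = {r}" and W_Suc: "\<And>n. W (Suc n) = W n \<union> hull (P (W n)) (W n) (nbrs G (W n))"
    by (simp_all add: W_def)
  have "W n \<noteq> {} \<and> W n \<subseteq> vertices G" for n
  proof (induction n)
    case (Suc n)
    then show ?case using hull_layer(1)[OF PD[OF Suc]] by (auto simp: W_Suc)
  qed (simp add: W_0 r)
  then have "layering G r W (\<lambda>n. P (W n)) (\<lambda>n. D (W n))"
    using G r W_0 W_Suc PD by unfold_locales auto
  then show ?thesis by blast
qed

theorem theorem4p3:
  fixes G :: "'a sgraph"
  assumes "simple_graph G" and "connected_graph G"
  shows "\<exists>T r. spanning_tree_of T G \<and> r \<in> vertices T \<and>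
           end_faithful_for T r (topological_ends G)"
proof -
  obtain r where r: "r \<in> vertices G"
    using assms(2) by (auto simp: connected_graph_def)
  obtain W p d where "layering G r W p d"
    using layering_exists[OF assms r] by blast
  then interpret layering G r W p d .
  show ?thesis
    using spanning end_faithful r by (intro exI[of _ tree] exI[of _ r]) (simp add: vertices_tree)
qed

end
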